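(* Let $\alpha_1,\alpha_2,\alpha_h>0$ with $\alpha_1+\alpha_2+\alpha_h=1$, let $\gamma_1,\gamma_2\in[0,1]$, and let $\theta_1,\theta_2\ge 0$ with $\theta_1+\theta_2\le 1$. Consider the two-attacker basic selfish mining Markov chain with $N=2$ described in the context, with stationary distribution $\pi$. Then $$\pi_{000}=\bigl(1+\alpha_1+\alpha_2+\alpha_1\alpha_h+2\alpha_1\alpha_2+\alpha_2\alpha_h+2\alpha_1\alpha_2\alpha_h\bigr)^{-1}.$$ The expected revenues $R_a,R_b,R_h$ of Alice, Bob and Henry (the expected numbers of valid blocks mined by them in a mining round) are calculated from the stationary distribution as $$R_a=2\alpha_1\pi_{100}+(2\alpha_1+(1-\alpha_1)\gamma_1)\pi_{101}+\alpha_1\pi_{011}+2\alpha_1\pi_{110}+(2\alpha_1+\alpha_h\theta_1)\pi_{111},$$ $$R_b=2\alpha_2\pi_{010}+(2\alpha_2+(1-\alpha_2)\gamma_2)\pi_{011}+\alpha_2\pi_{101}+2\alpha_2\pi_{110}+(2\alpha_2+\alpha_h\theta_2)\pi_{111},$$ $$R_h=(\alpha_h+(1-\alpha_1)(1-\gamma_1))\pi_{101}+\alpha_h(2-\theta_1-\theta_2)\pi_{111}+(\alpha_h+(1-\alpha_2)(1-\gamma_2))\pi_{011}+\alpha_h\pi_{000},$$ and in closed form $$R_a=\pi_{000}\bigl[2\alpha_1^2(1+\alpha_h)+(\alpha_2+\alpha_h)\alpha_1\alpha_h\gamma_1+\alpha_1\alpha_2\alpha_h+4\alpha_1^2\alpha_2(1+\alpha_h)+2\alpha_1\alpha_2\alpha_h^2\theta_1\bigr],$$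 $$R_b=\pi_{000}\bigl[2\alpha_2^2(1+\alpha_h)+(\alpha_1+\alpha_h)\alpha_2\alpha_h\gamma_2+\alpha_1\alpha_2\alpha_h+4\alpha_2^2\alpha_1(1+\alpha_h)+2\alpha_1\alpha_2\alpha_h^2\theta_2\bigr],$$ $$R_h=\pi_{000}\bigl[\alpha_1\alpha_h^2(2-\gamma_1)+2\alpha_1\alpha_2\alpha_h^2(2-\theta_1-\theta_2)+\alpha_h+\alpha_2\alpha_h^2(2-\gamma_2)+\alpha_1\alpha_2\alpha_h(2-\gamma_1-\gamma_2)\bigr].$$ The relative revenue of miner $i\in\{a,b,h\}$ is $\hat R_i=R_i/(R_a+R_b+R_h)$. The average number of Henry's orphaned blocks in each attack round is calculated as $$O_h=\pi_{000}\bigl[(\alpha_1+(1-\alpha_1)\gamma_1)\alpha_1\alpha_h+(\alpha_2+(1-\alpha_2)\gamma_2)\alpha_2\alpha_h+(\alpha_1+\alpha_2+(\theta_1+\theta_2)\alpha_h)\,2\alpha_1\alpha_2\alpha_h\bigr].$$ In the special case $\alpha_1=\alpha_2=\alpha<\tfrac12$, $\gamma_1=\gamma_2=\tfrac12$, $\theta_1=\theta_2=\tfrac13$, $$\pi_{000}=(1+4\alpha-4\alpha^3)^{-1},\qquad R_a=R_b=\pi_{000}\cdot\tfrac16\,\alpha\,(25\alpha+2\alpha^2+3-32\alpha^3),$$ $$R_h=\pi_{000}\,(1-2\alpha)\Bigl(1+3\alpha-\tfrac73\alpha^2-\tfrac{16}{3}\alpha^3\Bigr).$$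
   Context: Alice and Bob are selfish miners and Henry is honest; their hash powers are $\alpha_1,\alpha_2,\alpha_h$. Each new block is mined, independently of the past, by Alice, Bob or Henry with probabilities $\alpha_1,\alpha_2,\alpha_h$. A selfish miner keeps the first block privately and releases his two private blocks immediately after mining the second one ($N=2$); if Henry publishes a block while some selfish miners hold one private block each, those miners immediately publish their blocks, producing a tie among equally long public chains. $\gamma_1$ (resp. $\gamma_2$) is the proportion of all hash power except Alice's (resp. Bob's) that mines after Alice's (resp. Bob's) released chain in a tie between Alice (resp. Bob) and Henry; $\theta_1,\theta_2$ are the probabilities that honest miners mine after Alice's and Bob's chain in the three-party tie. A mining round is the process in which all miners start mining on the same public chain, go through a series of block-hiding and block-releasing actions, and finally reach a consensus on the public chain again. Valid blocks are confirmed blocks in the longest chain. By definition $R_a,R_b,R_h$ are the expected numbers of valid blocks mined by Alice, Bob and Henry in a mining round. A state $(i,j,k)$ records the lengths of Alice's, Bob's and Henry's chains; $\pi_{ijk}$ is its stationary probability. The discrete-time Markov chain has states $000,100,010,110,101,011,111$; transitions to $000$ mean that the forked chains return to a unanimous public chain, and they determine the block rewards as follows. - From $000$: to $100$ w.p. $\alpha_1$; to $010$ w.p. $\alpha_2$; to $000$ w.p. $\alpha_h$ (Henry gets 1). - From $100$: to $000$ w.p. $\alpha_1$ (Alice gets 2); to $110$ w.p. $\alpha_2$; to $101$ w.p. $\alpha_h$. - From $010$: to $000$ w.p. $\alpha_2$ (Bob gets 2); to $110$ w.p. $\alpha_1$; to $011$ w.p. $\alpha_h$. - From $110$: to $000$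 w.p. $\alpha_1$ (Alice gets 2); to $000$ w.p. $\alpha_2$ (Bob gets 2); to $111$ w.p. $\alpha_h$. - From $101$ (tie between Alice and Henry): always to $000$. If Alice mines the next block she gets 2. If Bob or Henry mines it, then with probability $\gamma_1$ it extends Alice's block (Alice gets 1, the miner of the new block gets 1), and with probability $1-\gamma_1$ it extends Henry's block (Henry gets 1 for the tied block, the miner of the new block gets 1). - From $011$ (tie between Bob and Henry): symmetric, with Bob in place of Alice and $\gamma_2$ in place of $\gamma_1$. - From $111$ (three-way tie): always to $000$. If Alice mines the next block she gets 2; if Bob mines it he gets 2; if Henry mines it, it extends Alice's block with probability $\theta_1$ (Alice 1, Henry 1), Bob's block with probability $\theta_2$ (Bob 1, Henry 1), and Henry's own block with probability $1-\theta_1-\theta_2$ (Henry 2).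
   Formalization: R_a, R_b, R_h and O_h are taken as stationary means per mined block, not per mining round: the displayed formulas are false per round by the factor π_000 (at least one block per round is valid). The per-round means are proved to be these values divided by π_000. *)

theory Defs
  imports "HOL-Probability.Probability"
begin

datatype miner = Alice | Bob | Henry

text \<open>The digits are the lengths of Alice's, Bob's and Henry's chains.\<close>

datatype state = S000 | S100 | S010 | S110 | S101 | S011 | S111

text \<open>
  One step of the chain is the mining of one block. Besides the new state it records the multisets
  of the miners of the blocks that become valid and of the blocks that become orphaned.
\<close>

type_synonym outcome = "state \<times> miner multiset \<times> miner multiset"

definition miner_pmf :: "real \<Rightarrow> real \<Rightarrow> real \<Rightarrow> miner pmf" where
  "miner_pmf a b h = pmf_of_list [(Alice, a), (Bob, b), (Henry, h)]"

definition continue :: "state \<Rightarrow> outcome" where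
  "continue s = (s, {#}, {#})"

text \<open>
  \<open>cs\<close> are the owners of the competing one-block chains, private or public. The next block is mined
  by \<open>m\<close> on the chain of \<open>w\<close>, which thereby wins; the first block of every other chain is orphaned.
\<close>

definition settle :: "miner multiset \<Rightarrow> miner \<Rightarrow> miner \<Rightarrow> outcome" where
  "settle cs w m = (S000, {#w, m#}, cs - {#w#})"

fun mining_step ::
  "real \<Rightarrow> real \<Rightarrow> real \<Rightarrow> real \<Rightarrow> real \<Rightarrow> real \<Rightarrow> real \<Rightarrow> state \<Rightarrow> outcome pmf"
where
  "mining_step \<alpha>\<^sub>1 \<alpha>\<^sub>2 \<alpha>\<^sub>h \<gamma>\<^sub>1 \<gamma>\<^sub>2 \<theta>\<^sub>1 \<theta>\<^sub>2 S000 =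
     map_pmf (\<lambda>m. case m of
         Alice \<Rightarrow> continue S100
       | Bob \<Rightarrow> continue S010
       | Henry \<Rightarrow> (S000, {#Henry#}, {#}))
     (miner_pmf \<alpha>\<^sub>1 \<alpha>\<^sub>2 \<alpha>\<^sub>h)"
| "mining_step \<alpha>\<^sub>1 \<alpha>\<^sub>2 \<alpha>\<^sub>h \<gamma>\<^sub>1 \<gamma>\<^sub>2 \<theta>\<^sub>1 \<theta>\<^sub>2 S100 =
     map_pmf (\<lambda>m. case m of
         Alice \<Rightarrow> settle {#Alice#} Alice Alice
       | Bob \<Rightarrow> continue S110
       | Henry \<Rightarrow> continue S101)
     (miner_pmf \<alpha>\<^sub>1 \<alpha>\<^sub>2 \<alpha>\<^sub>h)"
| "mining_step \<alpha>\<^sub>1 \<alpha>\<^sub>2 \<alpha>\<^sub>h \<gamma>\<^sub>1 \<gamma>\<^sub>2 \<theta>\<^sub>1 \<theta>\<^sub>2 S010 =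
     map_pmf (\<lambda>m. case m of
         Alice \<Rightarrow> continue S110
       | Bob \<Rightarrow> settle {#Bob#} Bob Bob
       | Henry \<Rightarrow> continue S011)
     (miner_pmf \<alpha>\<^sub>1 \<alpha>\<^sub>2 \<alpha>\<^sub>h)"
| "mining_step \<alpha>\<^sub>1 \<alpha>\<^sub>2 \<alpha>\<^sub>h \<gamma>\<^sub>1 \<gamma>\<^sub>2 \<theta>\<^sub>1 \<theta>\<^sub>2 S110 =
     map_pmf (\<lambda>m. case m of
         Alice \<Rightarrow> settle {#Alice, Bob#} Alice Alice
       | Bob \<Rightarrow> settle {#Alice, Bob#} Bob Bob
       | Henry \<Rightarrow> continue S111)
     (miner_pmf \<alpha>\<^sub>1 \<alpha>\<^sub>2 \<alpha>\<^sub>h)"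
| "mining_step \<alpha>\<^sub>1 \<alpha>\<^sub>2 \<alpha>\<^sub>h \<gamma>\<^sub>1 \<gamma>\<^sub>2 \<theta>\<^sub>1 \<theta>\<^sub>2 S101 =
     bind_pmf (miner_pmf \<alpha>\<^sub>1 \<alpha>\<^sub>2 \<alpha>\<^sub>h) (\<lambda>m.
       if m = Alice then return_pmf (settle {#Alice, Henry#} Alice Alice)
       else map_pmf (\<lambda>b. settle {#Alice, Henry#} (if b then Alice else Henry) m) (bernoulli_pmf \<gamma>\<^sub>1))"
| "mining_step \<alpha>\<^sub>1 \<alpha>\<^sub>2 \<alpha>\<^sub>h \<gamma>\<^sub>1 \<gamma>\<^sub>2 \<theta>\<^sub>1 \<theta>\<^sub>2 S011 =
     bind_pmf (miner_pmf \<alpha>\<^sub>1 \<alpha>\<^sub>2 \<alpha>\<^sub>h) (\<lambda>m.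
       if m = Bob then return_pmf (settle {#Bob, Henry#} Bob Bob)
       else map_pmf (\<lambda>b. settle {#Bob, Henry#} (if b then Bob else Henry) m) (bernoulli_pmf \<gamma>\<^sub>2))"
| "mining_step \<alpha>\<^sub>1 \<alpha>\<^sub>2 \<alpha>\<^sub>h \<gamma>\<^sub>1 \<gamma>\<^sub>2 \<theta>\<^sub>1 \<theta>\<^sub>2 S111 =
     bind_pmf (miner_pmf \<alpha>\<^sub>1 \<alpha>\<^sub>2 \<alpha>\<^sub>h) (\<lambda>m.
       if m = Henry
       then map_pmf (\<lambda>w. settle {#Alice, Bob, Henry#} w Henry) (miner_pmf \<theta>\<^sub>1 \<theta>\<^sub>2 (1 - \<theta>\<^sub>1 - \<theta>\<^sub>2))
       else return_pmf (settle {#Alice, Bob, Henry#} m m))"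

definition stationary :: "(state \<Rightarrow> outcome pmf) \<Rightarrow> state pmf \<Rightarrow> bool" where
  "stationary K \<pi> \<longleftrightarrow> bind_pmf \<pi> (\<lambda>s. map_pmf fst (K s)) = \<pi>"

text \<open>
  Means under the stationary distribution are taken per step of the chain, that is, per mined block.
  The mean over a whole mining round (an excursion from \<open>S000\<close> to the next visit of \<open>S000\<close>) is
  larger by the factor \<open>1 / pmf \<pi> S000\<close>, the mean number of steps of a round.
\<close>

definition revenue :: "(state \<Rightarrow> outcome pmf) \<Rightarrow> state pmf \<Rightarrow> miner \<Rightarrow> real" where
  "revenue K \<pi> m =
     measure_pmf.expectation (bind_pmf \<pi> K) (\<lambda>(_, valid, _). real (count valid m))"

definition mean_orphans :: "(state \<Rightarrow> outcome pmf) \<Rightarrow> state pmf \<Rightarrow> miner \<Rightarrow> real" where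
  "mean_orphans K \<pi> m =
     measure_pmf.expectation (bind_pmf \<pi> K) (\<lambda>(_, _, orphaned). real (count orphaned m))"

definition relative_revenue :: "(state \<Rightarrow> outcome pmf) \<Rightarrow> state pmf \<Rightarrow> miner \<Rightarrow> real" where
  "relative_revenue K \<pi> m =
     revenue K \<pi> m / (revenue K \<pi> Alice + revenue K \<pi> Bob + revenue K \<pi> Henry)"

text \<open>
  The blocks that become valid and orphaned from state \<open>s\<close> until the current mining round ends,
  where only the first \<open>n\<close> steps are counted.
\<close>

primrec round_blocks ::
  "(state \<Rightarrow> outcome pmf) \<Rightarrow> nat \<Rightarrow> state \<Rightarrow> (miner multiset \<times> miner multiset) pmf"
where
  "round_blocks K 0 s = return_pmf ({#}, {#})"
| "round_blocks K (Suc n) s =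
     bind_pmf (K s) (\<lambda>(t, valid, orphaned).
       if t = S000 then return_pmf (valid, orphaned)
       else map_pmf (\<lambda>(valid', orphaned'). (valid + valid', orphaned + orphaned'))
              (round_blocks K n t))"

definition round_valid :: "(state \<Rightarrow> outcome pmf) \<Rightarrow> nat \<Rightarrow> miner \<Rightarrow> real" where
  "round_valid K n m =
     measure_pmf.expectation (round_blocks K n S000) (\<lambda>(valid, _). real (count valid m))"

definition round_orphans :: "(state \<Rightarrow> outcome pmf) \<Rightarrow> nat \<Rightarrow> miner \<Rightarrow> real" where
  "round_orphans K n m =
     measure_pmf.expectation (round_blocks K n S000) (\<lambda>(_, orphaned). real (count orphaned m))"

end

(* A round lasts at most four steps, and up to the factor pi_000 the stationary distribution is the
   expected number of visits to each state in a round, namely 1, a1, a2, 2 a1 a2, a1 ah, a2 ah and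
   2 a1 a2 ah. Every mean, whether per step or per round, is therefore a combination of the
   one-step means of the seven states with these weights. *)

theory Submission imports Defs begin

section \<open>Expectations over the finite types of miners and states\<close>

lemma UNIV_miner: "(UNIV :: miner set) = {Alice, Bob, Henry}"
  using miner.exhaust by auto

lemma UNIV_state: "(UNIV :: state set) = {S000, S100, S010, S110, S101, S011, S111}"
  using state.exhaust by auto

lemma finite_set_pmf_miner: "finite (set_pmf (p :: miner pmf))"
  by (rule finite_subset[OF subset_UNIV]) (simp add: UNIV_miner)

lemma finite_set_pmf_state: "finite (set_pmf (p :: state pmf))"
  by (rule finite_subset[OF subset_UNIV]) (simp add: UNIV_state)

lemma sum_pmf_state:
  "pmf \<pi> S000 + pmf \<pi> S100 + pmf \<pi> S010 + pmf \<pi> S110 + pmf \<pi> S101 + pmf \<pi> S011 + pmf \<pi> S111 = 1"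
  using sum_pmf_eq_1[OF _ subset_UNIV, of \<pi>] by (simp add: UNIV_state)

text \<open>The law of total expectation. With finite supports every \<open>f\<close> is integrable,
  so the finite sum supplied by \<open>pmf_expectation_bind\<close> can be folded back into an
  integral over \<open>p\<close>.\<close>

lemma expectation_bind_finite:
  fixes f :: "'b \<Rightarrow> real"
  assumes "finite (set_pmf p)" "\<And>x. x \<in> set_pmf p \<Longrightarrow> finite (set_pmf (k x))"
  shows "measure_pmf.expectation (bind_pmf p k) f =
    measure_pmf.expectation p (\<lambda>x. measure_pmf.expectation (k x) f)"
  using pmf_expectation_bind[of "set_pmf p" k p f] integral_measure_pmf_real[of "set_pmf p" p] assms
  by (simp add: mult.commute)

lemma expectation_state:
  fixes f :: "state \<Rightarrow> real"
  shows "measure_pmf.expectation \<pi> f =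
    pmf \<pi> S000 * f S000 + pmf \<pi> S100 * f S100 + pmf \<pi> S010 * f S010 + pmf \<pi> S110 * f S110
    + pmf \<pi> S101 * f S101 + pmf \<pi> S011 * f S011 + pmf \<pi> S111 * f S111"
  by (subst integral_measure_pmf_real[of UNIV]) (simp_all add: UNIV_state mult.commute, metis state.exhaust)

text \<open>The weights are arbitrary because \<open>miner_pmf\<close> serves twice: for the hash
  powers, and for the choice of chain by Henry in the three-way tie.\<close>

lemma expectation_miner:
  fixes f :: "miner \<Rightarrow> real"
  assumes "a \<ge> 0" "b \<ge> 0" "h \<ge> 0" "a + b + h = 1"
  shows "measure_pmf.expectation (miner_pmf a b h) f = a * f Alice + b * f Bob + h * f Henry"
proof -
  have wf: "pmf_of_list_wf [(Alice, a), (Bob, b), (Henry, h)]"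
    using assms by (auto simp: pmf_of_list_wf_def)
  show ?thesis
    by (subst integral_measure_pmf_real[of UNIV])
      (simp_all add: UNIV_miner miner_pmf_def pmf_pmf_of_list[OF wf], metis miner.exhaust)
qed

section \<open>One-step means of the mining chain\<close>

locale selfish_mining =
  fixes \<alpha>\<^sub>1 \<alpha>\<^sub>2 \<alpha>\<^sub>h \<gamma>\<^sub>1 \<gamma>\<^sub>2 \<theta>\<^sub>1 \<theta>\<^sub>2 :: real
  assumes hash_powers: "\<alpha>\<^sub>1 > 0" "\<alpha>\<^sub>2 > 0" "\<alpha>\<^sub>h > 0" "\<alpha>\<^sub>1 + \<alpha>\<^sub>2 + \<alpha>\<^sub>h = 1"
    and gammas: "\<gamma>\<^sub>1 \<in> {0..1}" "\<gamma>\<^sub>2 \<in> {0..1}"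
    and thetas: "\<theta>\<^sub>1 \<ge> 0" "\<theta>\<^sub>2 \<ge> 0" "\<theta>\<^sub>1 + \<theta>\<^sub>2 \<le> 1"
begin

text \<open>A separate constant, so that simplification sees the chain through its one-step means;
  among the lemmas only \<open>finite_set_pmf_K\<close> and \<open>expectation_K\<close> unfold
  it.\<close>

definition K :: "state \<Rightarrow> outcome pmf" where
  "K = mining_step \<alpha>\<^sub>1 \<alpha>\<^sub>2 \<alpha>\<^sub>h \<gamma>\<^sub>1 \<gamma>\<^sub>2 \<theta>\<^sub>1 \<theta>\<^sub>2"

lemma expectation_hash_power:
  fixes f :: "miner \<Rightarrow> real"
  shows "measure_pmf.expectation (miner_pmf \<alpha>\<^sub>1 \<alpha>\<^sub>2 \<alpha>\<^sub>h) f = \<alpha>\<^sub>1 * f Alice + \<alpha>\<^sub>2 * f Bob + \<alpha>\<^sub>h * f Henry"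
  using hash_powers by (intro expectation_miner) auto

lemma finite_set_pmf_K: "finite (set_pmf (K s))"
  by (cases s) (auto simp: K_def finite_set_pmf_miner)

lemma expectation_step:
  fixes f :: "outcome \<Rightarrow> real"
  shows "measure_pmf.expectation (bind_pmf \<pi> K) f =
    measure_pmf.expectation \<pi> (\<lambda>s. measure_pmf.expectation (K s) f)"
  by (rule expectation_bind_finite) (simp_all add: finite_set_pmf_K finite_set_pmf_state)

text \<open>The transition table in a form that serves all purposes: indicators for \<open>f\<close>
  give the balance equations, block counts give revenues and orphans, and the continuation of a
  round gives its recursion.\<close>

lemma expectation_K:
  fixes f :: "outcome \<Rightarrow> real"
  shows
  "measure_pmf.expectation (K S000) f =
     \<alpha>\<^sub>1 * f (continue S100) + \<alpha>\<^sub>2 * f (continue S010) + \<alpha>\<^sub>h * f (S000, {#Henry#}, {#})"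
  "measure_pmf.expectation (K S100) f =
     \<alpha>\<^sub>1 * f (settle {#Alice#} Alice Alice) + \<alpha>\<^sub>2 * f (continue S110) + \<alpha>\<^sub>h * f (continue S101)"
  "measure_pmf.expectation (K S010) f =
     \<alpha>\<^sub>1 * f (continue S110) + \<alpha>\<^sub>2 * f (settle {#Bob#} Bob Bob) + \<alpha>\<^sub>h * f (continue S011)"
  "measure_pmf.expectation (K S110) f =
     \<alpha>\<^sub>1 * f (settle {#Alice, Bob#} Alice Alice) + \<alpha>\<^sub>2 * f (settle {#Alice, Bob#} Bob Bob)
     + \<alpha>\<^sub>h * f (continue S111)"
  "measure_pmf.expectation (K S101) f =
     \<alpha>\<^sub>1 * f (settle {#Alice, Henry#} Alice Alice)
     + \<alpha>\<^sub>2 * (\<gamma>\<^sub>1 * f (settle {#Alice, Henry#} Alice Bob)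
        + (1 - \<gamma>\<^sub>1) * f (settle {#Alice, Henry#} Henry Bob))
     + \<alpha>\<^sub>h * (\<gamma>\<^sub>1 * f (settle {#Alice, Henry#} Alice Henry)
        + (1 - \<gamma>\<^sub>1) * f (settle {#Alice, Henry#} Henry Henry))"
  "measure_pmf.expectation (K S011) f =
     \<alpha>\<^sub>1 * (\<gamma>\<^sub>2 * f (settle {#Bob, Henry#} Bob Alice)
        + (1 - \<gamma>\<^sub>2) * f (settle {#Bob, Henry#} Henry Alice))
     + \<alpha>\<^sub>2 * f (settle {#Bob, Henry#} Bob Bob)
     + \<alpha>\<^sub>h * (\<gamma>\<^sub>2 * f (settle {#Bob, Henry#} Bob Henry)
        + (1 - \<gamma>\<^sub>2) * f (settle {#Bob, Henry#} Henry Henry))"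
  "measure_pmf.expectation (K S111) f =
     \<alpha>\<^sub>1 * f (settle {#Alice, Bob, Henry#} Alice Alice)
     + \<alpha>\<^sub>2 * f (settle {#Alice, Bob, Henry#} Bob Bob)
     + \<alpha>\<^sub>h * (\<theta>\<^sub>1 * f (settle {#Alice, Bob, Henry#} Alice Henry)
        + \<theta>\<^sub>2 * f (settle {#Alice, Bob, Henry#} Bob Henry)
        + (1 - \<theta>\<^sub>1 - \<theta>\<^sub>2) * f (settle {#Alice, Bob, Henry#} Henry Henry))"
  using gammas thetas
  by (simp_all add: K_def expectation_hash_power expectation_miner expectation_bind_finite
      finite_set_pmf_miner mult.commute)

section \<open>The stationary distribution\<close>

text \<open>Apart from \<open>S000\<close>, each state is entered only from states that lie fewer
  steps after \<open>S000\<close>, so the balance equations can be solved one after another in terms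
  of \<open>pmf \<pi> S000\<close>. The factor 2 at \<open>S110\<close> counts the two orders in
  which Alice and Bob may mine their hidden blocks, and \<open>S111\<close> inherits it.\<close>

lemma stationary_iff:
  "stationary K \<pi> \<longleftrightarrow>
    pmf \<pi> S100 = \<alpha>\<^sub>1 * pmf \<pi> S000 \<and> pmf \<pi> S010 = \<alpha>\<^sub>2 * pmf \<pi> S000 \<and>
    pmf \<pi> S110 = 2 * \<alpha>\<^sub>1 * \<alpha>\<^sub>2 * pmf \<pi> S000 \<and>
    pmf \<pi> S101 = \<alpha>\<^sub>1 * \<alpha>\<^sub>h * pmf \<pi> S000 \<and> pmf \<pi> S011 = \<alpha>\<^sub>2 * \<alpha>\<^sub>h * pmf \<pi> S000 \<and>
    pmf \<pi> S111 = 2 * \<alpha>\<^sub>1 * \<alpha>\<^sub>2 * \<alpha>\<^sub>h * pmf \<pi> S000"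
  (is "_ \<longleftrightarrow> ?visits")
proof -
  \<comment> \<open>A probability is the mean of an indicator, so \<open>expectation_K\<close> also
    yields the transition probabilities.\<close>
  have inflow: "pmf (bind_pmf \<pi> (\<lambda>s. map_pmf fst (K s))) t =
      measure_pmf.expectation \<pi> (\<lambda>s. measure_pmf.expectation (K s) (\<lambda>x. indicator {t} (fst x)))" for t
  proof -
    have "pmf (map_pmf fst p) t = measure_pmf.expectation p (\<lambda>x. indicator {t} (fst x))"
      for p :: "outcome pmf"
      using integral_map_pmf[of fst p "indicator {t} :: state \<Rightarrow> real"] by (simp add: pmf.rep_eq)
    then show ?thesis
      by (simp add: pmf_bind)
  qed
  note flow = inflow expectation_state expectation_K continue_def settle_def
  \<comment> \<open>The quantifier is bounded by \<open>UNIV\<close> so that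
    \<open>UNIV_state\<close> can split it into seven equations.\<close>
  have "stationary K \<pi> \<longleftrightarrow>
      (\<forall>t \<in> UNIV. pmf (bind_pmf \<pi> (\<lambda>s. map_pmf fst (K s))) t = pmf \<pi> t)"
    by (simp add: stationary_def pmf_eq_iff)
  also have "\<dots> \<longleftrightarrow> ?visits"
  proof
    assume "\<forall>t \<in> UNIV. pmf (bind_pmf \<pi> (\<lambda>s. map_pmf fst (K s))) t = pmf \<pi> t"
    then have "pmf \<pi> S100 = \<alpha>\<^sub>1 * pmf \<pi> S000" "pmf \<pi> S010 = \<alpha>\<^sub>2 * pmf \<pi> S000"
      "pmf \<pi> S110 = \<alpha>\<^sub>2 * pmf \<pi> S100 + \<alpha>\<^sub>1 * pmf \<pi> S010"
      "pmf \<pi> S101 = \<alpha>\<^sub>h * pmf \<pi> S100" "pmf \<pi> S011 = \<alpha>\<^sub>h * pmf \<pi> S010"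
      "pmf \<pi> S111 = \<alpha>\<^sub>h * pmf \<pi> S110"
      unfolding UNIV_state by (simp_all add: flow mult.commute)
    then show ?visits
      by (simp add: algebra_simps)
  next
    assume visits: ?visits
    have rest: "pmf (bind_pmf \<pi> (\<lambda>s. map_pmf fst (K s))) t = pmf \<pi> t" if "t \<noteq> S000" for t
      using that visits by (cases t) (simp_all add: flow algebra_simps)
    \<comment> \<open>Both distributions have total mass 1 and agree on the six other states, which
      forces the balance at \<open>S000\<close>.\<close>
    moreover have "pmf (bind_pmf \<pi> (\<lambda>s. map_pmf fst (K s))) S000 = pmf \<pi> S000"
      using sum_pmf_state[of \<pi>] sum_pmf_state[of "bind_pmf \<pi> (\<lambda>s. map_pmf fst (K s))"]
      by (simp add: rest)
    ultimately show "\<forall>t \<in> UNIV. pmf (bind_pmf \<pi> (\<lambda>s. map_pmf fst (K s))) t = pmf \<pi> t"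
      by metis
  qed
  finally show ?thesis .
qed

text \<open>The normalising constant: the sum of the coefficients in \<open>stationary_iff\<close>,
  with 1 for \<open>S000\<close> itself.\<close>

definition steps_per_round :: real where
  "steps_per_round =
    1 + \<alpha>\<^sub>1 + \<alpha>\<^sub>2 + \<alpha>\<^sub>1 * \<alpha>\<^sub>h + 2 * \<alpha>\<^sub>1 * \<alpha>\<^sub>2 + \<alpha>\<^sub>2 * \<alpha>\<^sub>h + 2 * \<alpha>\<^sub>1 * \<alpha>\<^sub>2 * \<alpha>\<^sub>h"

lemma steps_per_round_pos: "steps_per_round > 0"
  unfolding steps_per_round_def using hash_powers by (intro add_pos_pos mult_pos_pos) auto

lemma stationary_S000:
  assumes "stationary K \<pi>"
  shows "pmf \<pi> S000 = inverse steps_per_round"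
proof -
  have "steps_per_round * pmf \<pi> S000 = 1"
    using sum_pmf_state[of \<pi>] assms unfolding stationary_iff steps_per_round_def
    by (simp add: algebra_simps)
  then show ?thesis
    using steps_per_round_pos by (simp add: field_simps)
qed

text \<open>The witness consists of the visit numbers divided by their sum. Uniqueness holds because
  normalisation fixes the mass of \<open>S000\<close> and \<open>stationary_iff\<close> makes every
  other mass a multiple of it.\<close>

lemma ex1_stationary: "\<exists>!\<pi>. stationary K \<pi>"
proof (rule ex_ex1I)
  let ?xs = "map (\<lambda>(s, w). (s, w / steps_per_round))
    [(S000, 1), (S100, \<alpha>\<^sub>1), (S010, \<alpha>\<^sub>2), (S110, 2 * \<alpha>\<^sub>1 * \<alpha>\<^sub>2), (S101, \<alpha>\<^sub>1 * \<alpha>\<^sub>h), (S011, \<alpha>\<^sub>2 * \<alpha>\<^sub>h),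
     (S111, 2 * \<alpha>\<^sub>1 * \<alpha>\<^sub>2 * \<alpha>\<^sub>h)]"
  have "sum_list (map snd ?xs) = (1 + \<alpha>\<^sub>1 + \<alpha>\<^sub>2 + \<alpha>\<^sub>1 * \<alpha>\<^sub>h + 2 * \<alpha>\<^sub>1 * \<alpha>\<^sub>2 + \<alpha>\<^sub>2 * \<alpha>\<^sub>h
      + 2 * \<alpha>\<^sub>1 * \<alpha>\<^sub>2 * \<alpha>\<^sub>h) / steps_per_round"
    by (simp add: add_divide_distrib)
  also have "\<dots> = 1"
    using steps_per_round_pos unfolding steps_per_round_def by simp
  finally have "pmf_of_list_wf ?xs"
    using hash_powers steps_per_round_pos by (auto simp: pmf_of_list_wf_def)
  from pmf_pmf_of_list[OF this] show "\<exists>\<pi>. stationary K \<pi>"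
    by (intro exI[of _ "pmf_of_list ?xs"]) (simp add: stationary_iff)
next
  fix \<pi> \<rho>
  assume st: "stationary K \<pi>" "stationary K \<rho>"
  show "\<pi> = \<rho>"
  proof (rule pmf_eqI)
    fix s show "pmf \<pi> s = pmf \<rho> s"
      using st stationary_S000[OF st(1)] stationary_S000[OF st(2)] unfolding stationary_iff
      by (cases s) simp_all
  qed
qed

section \<open>Block counts over a whole mining round\<close>

lemma finite_set_pmf_round_blocks: "finite (set_pmf (round_blocks K n s))"
  by (induction n arbitrary: s) (auto simp: finite_set_pmf_K)

text \<open>First-step analysis. Additivity of \<open>F\<close> separates the blocks of the first
  step from the later ones. The test for \<open>S000\<close> concerns the state reached, so a round
  may start at \<open>S000\<close> without ending there.\<close>

lemma expectation_round_blocks_Suc: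
  fixes F :: "miner multiset \<times> miner multiset \<Rightarrow> real"
  assumes add: "\<And>v v' u u'. F (v + v', u + u') = F (v, u) + F (v', u')"
  shows "measure_pmf.expectation (round_blocks K (Suc n) s) F =
    measure_pmf.expectation (K s) (\<lambda>x. F (snd x))
    + measure_pmf.expectation (K s) (\<lambda>x. if fst x = S000 then 0
        else measure_pmf.expectation (round_blocks K n (fst x)) F)"
proof -
  let ?rest = "\<lambda>t. if t = S000 then 0 else measure_pmf.expectation (round_blocks K n t) F"
  have after: "measure_pmf.expectation (map_pmf (\<lambda>(v', u'). (v + v', u + u')) (round_blocks K n t)) F =
      F (v, u) + measure_pmf.expectation (round_blocks K n t) F" for t v u
    by (simp add: add case_prod_unfold integrable_measure_pmf_finite finite_set_pmf_round_blocks)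
  have "measure_pmf.expectation (round_blocks K (Suc n) s) F =
      measure_pmf.expectation (K s) (\<lambda>x. F (snd x) + ?rest (fst x))"
    unfolding round_blocks.simps
    \<comment> \<open>\<open>integral_map_pmf\<close> would rewrite the left-hand side of
      \<open>after\<close> before that fact could apply.\<close>
    by (subst expectation_bind_finite)
      (auto simp: finite_set_pmf_K finite_set_pmf_round_blocks after
        simp del: integral_map_pmf intro!: Bochner_Integration.integral_cong)
  then show ?thesis
    by (simp add: integrable_measure_pmf_finite finite_set_pmf_K)
qed

text \<open>The renewal-reward identity for this chain: the factors of \<open>pmf \<pi> S000\<close>
  in \<open>stationary_iff\<close> are the expected visits in a round, so dividing a per-step mean
  by \<open>pmf \<pi> S000\<close> gives the mean per round. Additive \<open>F\<close> covers valid
  and orphaned blocks alike.\<close>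

lemma expectation_round_blocks:
  fixes F :: "miner multiset \<times> miner multiset \<Rightarrow> real"
  assumes add: "\<And>v v' u u'. F (v + v', u + u') = F (v, u) + F (v', u')"
    and st: "stationary K \<pi>" and "n \<ge> 4"
  shows "measure_pmf.expectation (round_blocks K n S000) F =
    measure_pmf.expectation (bind_pmf \<pi> K) (\<lambda>x. F (snd x)) / pmf \<pi> S000"
proof -
  define r where "r s = measure_pmf.expectation (K s) (\<lambda>x. F (snd x))" for s
  \<comment> \<open>The longest rounds pass through \<open>S100\<close> or \<open>S010\<close>, then
    \<open>S110\<close> and \<open>S111\<close>, and take four steps. Four unfoldings of the
    recursion exhaust every path, and \<open>k\<close> drops out.\<close>
  obtain k where n: "n = Suc (Suc (Suc (Suc k)))"
    using \<open>n \<ge> 4\<close> by (metis add_2_eq_Suc numeral_Bit0 le_Suc_ex add_Suc)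
  define e where "e n s = measure_pmf.expectation (round_blocks K n s) F" for n s
  have e_Suc: "e (Suc n) s =
      r s + measure_pmf.expectation (K s) (\<lambda>x. if fst x = S000 then 0 else e n (fst x))" for n s
    unfolding e_def r_def by (rule expectation_round_blocks_Suc[OF add])
  have "e n S000 =
      r S000 + \<alpha>\<^sub>1 * r S100 + \<alpha>\<^sub>2 * r S010 + 2 * \<alpha>\<^sub>1 * \<alpha>\<^sub>2 * r S110 + \<alpha>\<^sub>1 * \<alpha>\<^sub>h * r S101
      + \<alpha>\<^sub>2 * \<alpha>\<^sub>h * r S011 + 2 * \<alpha>\<^sub>1 * \<alpha>\<^sub>2 * \<alpha>\<^sub>h * r S111"
    by (simp add: n e_Suc expectation_K continue_def settle_def) (simp add: algebra_simps)
  moreover have "measure_pmf.expectation (bind_pmf \<pi> K) (\<lambda>x. F (snd x)) =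
      measure_pmf.expectation \<pi> r"
    unfolding r_def by (rule expectation_step)
  moreover have "pmf \<pi> S000 > 0"
    using stationary_S000[OF st] steps_per_round_pos by simp
  ultimately show ?thesis
    using st unfolding stationary_iff by (simp add: expectation_state e_def field_simps)
qed

text \<open>Truncation has no effect from four steps on, so the sequence is eventually constant and
  its limit is the mean over a complete round.\<close>

lemma round_valid_tendsto:
  assumes "stationary K \<pi>"
  shows "(\<lambda>n. round_valid K n m) \<longlonglongrightarrow> revenue K \<pi> m / pmf \<pi> S000"
  using expectation_round_blocks[OF _ assms, of "\<lambda>(v, _). real (count v m)"]
  by (intro tendsto_eventually eventually_sequentiallyI[of 4])
    (simp add: round_valid_def revenue_def case_prod_unfold)

lemma round_orphans_tendsto:
  assumes "stationary K \<pi>"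
  shows "(\<lambda>n. round_orphans K n m) \<longlonglongrightarrow> mean_orphans K \<pi> m / pmf \<pi> S000"
  using expectation_round_blocks[OF _ assms, of "\<lambda>(_, u). real (count u m)"]
  by (intro tendsto_eventually eventually_sequentiallyI[of 4])
    (simp add: round_orphans_def mean_orphans_def case_prod_unfold)

section \<open>Revenues and orphans per step\<close>

text \<open>Used as a rewrite rule: eliminating \<open>\<alpha>\<^sub>h\<close> turns identities
  that hold modulo the sum of the hash powers into polynomial identities.\<close>

lemma honest_power: "\<alpha>\<^sub>h = 1 - \<alpha>\<^sub>1 - \<alpha>\<^sub>2"
  using hash_powers by simp

lemmas step_simps = expectation_step expectation_state expectation_K continue_def settle_def

text \<open>In \<open>S101\<close> Alice earns 2 by mining herself, and otherwise 1 with probability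
  \<open>\<gamma>\<^sub>1\<close>. In \<open>S011\<close> a block of hers becomes valid whichever
  chain it extends, hence the plain factor \<open>\<alpha>\<^sub>1\<close>.\<close>

lemma revenue_Alice:
  "revenue K \<pi> Alice =
    2 * \<alpha>\<^sub>1 * pmf \<pi> S100 + (2 * \<alpha>\<^sub>1 + (1 - \<alpha>\<^sub>1) * \<gamma>\<^sub>1) * pmf \<pi> S101 + \<alpha>\<^sub>1 * pmf \<pi> S011
    + 2 * \<alpha>\<^sub>1 * pmf \<pi> S110 + (2 * \<alpha>\<^sub>1 + \<alpha>\<^sub>h * \<theta>\<^sub>1) * pmf \<pi> S111"
  by (simp add: revenue_def step_simps) (simp add: honest_power algebra_simps)

lemma revenue_Bob:
  "revenue K \<pi> Bob =
    2 * \<alpha>\<^sub>2 * pmf \<pi> S010 + (2 * \<alpha>\<^sub>2 + (1 - \<alpha>\<^sub>2) * \<gamma>\<^sub>2) * pmf \<pi> S011 + \<alpha>\<^sub>2 * pmf \<pi> S101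
    + 2 * \<alpha>\<^sub>2 * pmf \<pi> S110 + (2 * \<alpha>\<^sub>2 + \<alpha>\<^sub>h * \<theta>\<^sub>2) * pmf \<pi> S111"
  by (simp add: revenue_def step_simps) (simp add: honest_power algebra_simps)

text \<open>In a tie Henry's new block always counts, which gives \<open>\<alpha>\<^sub>h\<close>;
  the remaining part of each coefficient is the chance that his tied block is extended.\<close>

lemma revenue_Henry:
  "revenue K \<pi> Henry =
    (\<alpha>\<^sub>h + (1 - \<alpha>\<^sub>1) * (1 - \<gamma>\<^sub>1)) * pmf \<pi> S101 + \<alpha>\<^sub>h * (2 - \<theta>\<^sub>1 - \<theta>\<^sub>2) * pmf \<pi> S111
    + (\<alpha>\<^sub>h + (1 - \<alpha>\<^sub>2) * (1 - \<gamma>\<^sub>2)) * pmf \<pi> S011 + \<alpha>\<^sub>h * pmf \<pi> S000"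
  by (simp add: revenue_def step_simps) (simp add: honest_power algebra_simps)

text \<open>Only a tied block of Henry can be orphaned, so each coefficient is the probability that
  the next block lands on another chain.\<close>

lemma mean_orphans_Henry:
  "mean_orphans K \<pi> Henry =
    (\<alpha>\<^sub>1 + (1 - \<alpha>\<^sub>1) * \<gamma>\<^sub>1) * pmf \<pi> S101 + (\<alpha>\<^sub>2 + (1 - \<alpha>\<^sub>2) * \<gamma>\<^sub>2) * pmf \<pi> S011
    + (\<alpha>\<^sub>1 + \<alpha>\<^sub>2 + (\<theta>\<^sub>1 + \<theta>\<^sub>2) * \<alpha>\<^sub>h) * pmf \<pi> S111"
  by (simp add: mean_orphans_def step_simps) (simp add: honest_power algebra_simps)

lemma revenue_nonneg: "revenue K \<pi> m \<ge> 0"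
  unfolding revenue_def by (intro Bochner_Integration.integral_nonneg) auto

text \<open>The blocks that Henry mines at consensus already give a positive amount; this keeps the
  denominator of the relative revenues away from 0.\<close>

lemma revenue_Henry_pos:
  assumes "stationary K \<pi>"
  shows "revenue K \<pi> Henry > 0"
proof -
  have "\<alpha>\<^sub>h * pmf \<pi> S000 > 0"
    using stationary_S000[OF assms] steps_per_round_pos hash_powers by simp
  moreover have "(\<alpha>\<^sub>h + (1 - \<alpha>\<^sub>1) * (1 - \<gamma>\<^sub>1)) * pmf \<pi> S101 \<ge> 0"
    "\<alpha>\<^sub>h * (2 - \<theta>\<^sub>1 - \<theta>\<^sub>2) * pmf \<pi> S111 \<ge> 0"
    "(\<alpha>\<^sub>h + (1 - \<alpha>\<^sub>2) * (1 - \<gamma>\<^sub>2)) * pmf \<pi> S011 \<ge> 0"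
    using hash_powers gammas thetas by (auto intro!: mult_nonneg_nonneg add_nonneg_nonneg)
  ultimately show ?thesis
    unfolding revenue_Henry by linarith
qed

section \<open>Closed forms and the symmetric case\<close>

lemma revenue_closed_forms:
  assumes "stationary K \<pi>"
  shows "revenue K \<pi> Alice = pmf \<pi> S000 *
      (2 * \<alpha>\<^sub>1^2 * (1 + \<alpha>\<^sub>h) + (\<alpha>\<^sub>2 + \<alpha>\<^sub>h) * \<alpha>\<^sub>1 * \<alpha>\<^sub>h * \<gamma>\<^sub>1 + \<alpha>\<^sub>1 * \<alpha>\<^sub>2 * \<alpha>\<^sub>h
       + 4 * \<alpha>\<^sub>1^2 * \<alpha>\<^sub>2 * (1 + \<alpha>\<^sub>h) + 2 * \<alpha>\<^sub>1 * \<alpha>\<^sub>2 * \<alpha>\<^sub>h^2 * \<theta>\<^sub>1)"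
    "revenue K \<pi> Bob = pmf \<pi> S000 *
      (2 * \<alpha>\<^sub>2^2 * (1 + \<alpha>\<^sub>h) + (\<alpha>\<^sub>1 + \<alpha>\<^sub>h) * \<alpha>\<^sub>2 * \<alpha>\<^sub>h * \<gamma>\<^sub>2 + \<alpha>\<^sub>1 * \<alpha>\<^sub>2 * \<alpha>\<^sub>h
       + 4 * \<alpha>\<^sub>2^2 * \<alpha>\<^sub>1 * (1 + \<alpha>\<^sub>h) + 2 * \<alpha>\<^sub>1 * \<alpha>\<^sub>2 * \<alpha>\<^sub>h^2 * \<theta>\<^sub>2)"
    "revenue K \<pi> Henry = pmf \<pi> S000 *
      (\<alpha>\<^sub>1 * \<alpha>\<^sub>h^2 * (2 - \<gamma>\<^sub>1) + 2 * \<alpha>\<^sub>1 * \<alpha>\<^sub>2 * \<alpha>\<^sub>h^2 * (2 - \<theta>\<^sub>1 - \<theta>\<^sub>2) + \<alpha>\<^sub>h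
       + \<alpha>\<^sub>2 * \<alpha>\<^sub>h^2 * (2 - \<gamma>\<^sub>2) + \<alpha>\<^sub>1 * \<alpha>\<^sub>2 * \<alpha>\<^sub>h * (2 - \<gamma>\<^sub>1 - \<gamma>\<^sub>2))"
proof -
  \<comment> \<open>The closed forms retain \<open>\<alpha>\<^sub>h\<close>, so here
    \<open>1 - \<alpha>\<^sub>1\<close> and \<open>1 - \<alpha>\<^sub>2\<close> are expanded instead
    of eliminating it; both sides then agree as polynomials.\<close>
  have others: "1 - \<alpha>\<^sub>1 = \<alpha>\<^sub>2 + \<alpha>\<^sub>h" "1 - \<alpha>\<^sub>2 = \<alpha>\<^sub>1 + \<alpha>\<^sub>h"
    using hash_powers by simp_all
  note visits = assms[unfolded stationary_iff]
  show "revenue K \<pi> Alice = pmf \<pi> S000 *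
      (2 * \<alpha>\<^sub>1^2 * (1 + \<alpha>\<^sub>h) + (\<alpha>\<^sub>2 + \<alpha>\<^sub>h) * \<alpha>\<^sub>1 * \<alpha>\<^sub>h * \<gamma>\<^sub>1 + \<alpha>\<^sub>1 * \<alpha>\<^sub>2 * \<alpha>\<^sub>h
       + 4 * \<alpha>\<^sub>1^2 * \<alpha>\<^sub>2 * (1 + \<alpha>\<^sub>h) + 2 * \<alpha>\<^sub>1 * \<alpha>\<^sub>2 * \<alpha>\<^sub>h^2 * \<theta>\<^sub>1)"
    by (simp add: revenue_Alice visits others) (simp add: algebra_simps power2_eq_square)
  show "revenue K \<pi> Bob = pmf \<pi> S000 *
      (2 * \<alpha>\<^sub>2^2 * (1 + \<alpha>\<^sub>h) + (\<alpha>\<^sub>1 + \<alpha>\<^sub>h) * \<alpha>\<^sub>2 * \<alpha>\<^sub>h * \<gamma>\<^sub>2 + \<alpha>\<^sub>1 * \<alpha>\<^sub>2 * \<alpha>\<^sub>h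
       + 4 * \<alpha>\<^sub>2^2 * \<alpha>\<^sub>1 * (1 + \<alpha>\<^sub>h) + 2 * \<alpha>\<^sub>1 * \<alpha>\<^sub>2 * \<alpha>\<^sub>h^2 * \<theta>\<^sub>2)"
    by (simp add: revenue_Bob visits others) (simp add: algebra_simps power2_eq_square)
  show "revenue K \<pi> Henry = pmf \<pi> S000 *
      (\<alpha>\<^sub>1 * \<alpha>\<^sub>h^2 * (2 - \<gamma>\<^sub>1) + 2 * \<alpha>\<^sub>1 * \<alpha>\<^sub>2 * \<alpha>\<^sub>h^2 * (2 - \<theta>\<^sub>1 - \<theta>\<^sub>2) + \<alpha>\<^sub>h
       + \<alpha>\<^sub>2 * \<alpha>\<^sub>h^2 * (2 - \<gamma>\<^sub>2) + \<alpha>\<^sub>1 * \<alpha>\<^sub>2 * \<alpha>\<^sub>h * (2 - \<gamma>\<^sub>1 - \<gamma>\<^sub>2))"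
    by (simp add: revenue_Henry visits others) (simp add: algebra_simps power2_eq_square)
qed

lemma mean_orphans_Henry_closed_form:
  assumes "stationary K \<pi>"
  shows "mean_orphans K \<pi> Henry = pmf \<pi> S000 *
    ((\<alpha>\<^sub>1 + (1 - \<alpha>\<^sub>1) * \<gamma>\<^sub>1) * \<alpha>\<^sub>1 * \<alpha>\<^sub>h + (\<alpha>\<^sub>2 + (1 - \<alpha>\<^sub>2) * \<gamma>\<^sub>2) * \<alpha>\<^sub>2 * \<alpha>\<^sub>h
     + (\<alpha>\<^sub>1 + \<alpha>\<^sub>2 + (\<theta>\<^sub>1 + \<theta>\<^sub>2) * \<alpha>\<^sub>h) * (2 * \<alpha>\<^sub>1 * \<alpha>\<^sub>2 * \<alpha>\<^sub>h))"
  using assms unfolding stationary_iff mean_orphans_Henry by (simp add: algebra_simps)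

lemma symmetric_case:
  assumes "stationary K \<pi>" "\<alpha>\<^sub>1 = \<alpha>" "\<alpha>\<^sub>2 = \<alpha>" "\<gamma>\<^sub>1 = 1/2" "\<gamma>\<^sub>2 = 1/2" "\<theta>\<^sub>1 = 1/3" "\<theta>\<^sub>2 = 1/3"
  shows "pmf \<pi> S000 = inverse (1 + 4 * \<alpha> - 4 * \<alpha>^3)"
    "revenue K \<pi> Alice = pmf \<pi> S000 * (1/6) * \<alpha> * (25 * \<alpha> + 2 * \<alpha>^2 + 3 - 32 * \<alpha>^3)"
    "revenue K \<pi> Bob = pmf \<pi> S000 * (1/6) * \<alpha> * (25 * \<alpha> + 2 * \<alpha>^2 + 3 - 32 * \<alpha>^3)"
    "revenue K \<pi> Henry = pmf \<pi> S000 * (1 - 2 * \<alpha>) * (1 + 3 * \<alpha> - (7/3) * \<alpha>^2 - (16/3) * \<alpha>^3)"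
proof -
  \<comment> \<open>The parameters are hidden arguments of \<open>K\<close> and
    \<open>steps_per_round\<close>. Hence those terms are unfolded first and \<open>spec\<close>
    only afterwards, since rewriting the parameters inside them would stop the facts from
    matching.\<close>
  note spec = honest_power assms(2-)
  have "steps_per_round = 1 + 4 * \<alpha> - 4 * \<alpha>^3"
    unfolding steps_per_round_def unfolding spec by (simp add: algebra_simps power3_eq_cube)
  then show "pmf \<pi> S000 = inverse (1 + 4 * \<alpha> - 4 * \<alpha>^3)"
    using stationary_S000[OF assms(1)] by simp
  show "revenue K \<pi> Alice = pmf \<pi> S000 * (1/6) * \<alpha> * (25 * \<alpha> + 2 * \<alpha>^2 + 3 - 32 * \<alpha>^3)"
    "revenue K \<pi> Bob = pmf \<pi> S000 * (1/6) * \<alpha> * (25 * \<alpha> + 2 * \<alpha>^2 + 3 - 32 * \<alpha>^3)"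
    "revenue K \<pi> Henry = pmf \<pi> S000 * (1 - 2 * \<alpha>) * (1 + 3 * \<alpha> - (7/3) * \<alpha>^2 - (16/3) * \<alpha>^3)"
    unfolding revenue_closed_forms[OF assms(1)] unfolding spec
    by (simp_all add: field_simps power2_eq_square power3_eq_cube)
qed

end

theorem mainTheorem1:
  fixes \<alpha>\<^sub>1 \<alpha>\<^sub>2 \<alpha>\<^sub>h \<gamma>\<^sub>1 \<gamma>\<^sub>2 \<theta>\<^sub>1 \<theta>\<^sub>2 :: real
    and K :: "state \<Rightarrow> outcome pmf"
  assumes "\<alpha>\<^sub>1 > 0" and "\<alpha>\<^sub>2 > 0" and "\<alpha>\<^sub>h > 0" and "\<alpha>\<^sub>1 + \<alpha>\<^sub>2 + \<alpha>\<^sub>h = 1"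
    and "\<gamma>\<^sub>1 \<in> {0..1}" and "\<gamma>\<^sub>2 \<in> {0..1}"
    and "\<theta>\<^sub>1 \<ge> 0" and "\<theta>\<^sub>2 \<ge> 0" and "\<theta>\<^sub>1 + \<theta>\<^sub>2 \<le> 1"
    and "K = mining_step \<alpha>\<^sub>1 \<alpha>\<^sub>2 \<alpha>\<^sub>h \<gamma>\<^sub>1 \<gamma>\<^sub>2 \<theta>\<^sub>1 \<theta>\<^sub>2"
  shows "(\<exists>!\<pi>. stationary K \<pi>) \<and>
    (\<forall>\<pi>. stationary K \<pi> \<longrightarrow>
      \<comment> \<open>stationary probability of consensus\<close>
      pmf \<pi> S000 = inverse (1 + \<alpha>\<^sub>1 + \<alpha>\<^sub>2 + \<alpha>\<^sub>1 * \<alpha>\<^sub>h + 2 * \<alpha>\<^sub>1 * \<alpha>\<^sub>2 + \<alpha>\<^sub>2 * \<alpha>\<^sub>h + 2 * \<alpha>\<^sub>1 * \<alpha>\<^sub>2 * \<alpha>\<^sub>h) \<and>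
      \<comment> \<open>expected revenues from the stationary distribution\<close>
      revenue K \<pi> Alice =
        2 * \<alpha>\<^sub>1 * pmf \<pi> S100 + (2 * \<alpha>\<^sub>1 + (1 - \<alpha>\<^sub>1) * \<gamma>\<^sub>1) * pmf \<pi> S101 + \<alpha>\<^sub>1 * pmf \<pi> S011
        + 2 * \<alpha>\<^sub>1 * pmf \<pi> S110 + (2 * \<alpha>\<^sub>1 + \<alpha>\<^sub>h * \<theta>\<^sub>1) * pmf \<pi> S111 \<and>
      revenue K \<pi> Bob =
        2 * \<alpha>\<^sub>2 * pmf \<pi> S010 + (2 * \<alpha>\<^sub>2 + (1 - \<alpha>\<^sub>2) * \<gamma>\<^sub>2) * pmf \<pi> S011 + \<alpha>\<^sub>2 * pmf \<pi> S101
        + 2 * \<alpha>\<^sub>2 * pmf \<pi> S110 + (2 * \<alpha>\<^sub>2 + \<alpha>\<^sub>h * \<theta>\<^sub>2) * pmf \<pi> S111 \<and>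
      revenue K \<pi> Henry =
        (\<alpha>\<^sub>h + (1 - \<alpha>\<^sub>1) * (1 - \<gamma>\<^sub>1)) * pmf \<pi> S101 + \<alpha>\<^sub>h * (2 - \<theta>\<^sub>1 - \<theta>\<^sub>2) * pmf \<pi> S111
        + (\<alpha>\<^sub>h + (1 - \<alpha>\<^sub>2) * (1 - \<gamma>\<^sub>2)) * pmf \<pi> S011 + \<alpha>\<^sub>h * pmf \<pi> S000 \<and>
      \<comment> \<open>expected revenues in closed form\<close>
      revenue K \<pi> Alice = pmf \<pi> S000 *
        (2 * \<alpha>\<^sub>1^2 * (1 + \<alpha>\<^sub>h) + (\<alpha>\<^sub>2 + \<alpha>\<^sub>h) * \<alpha>\<^sub>1 * \<alpha>\<^sub>h * \<gamma>\<^sub>1 + \<alpha>\<^sub>1 * \<alpha>\<^sub>2 * \<alpha>\<^sub>h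
         + 4 * \<alpha>\<^sub>1^2 * \<alpha>\<^sub>2 * (1 + \<alpha>\<^sub>h) + 2 * \<alpha>\<^sub>1 * \<alpha>\<^sub>2 * \<alpha>\<^sub>h^2 * \<theta>\<^sub>1) \<and>
      revenue K \<pi> Bob = pmf \<pi> S000 *
        (2 * \<alpha>\<^sub>2^2 * (1 + \<alpha>\<^sub>h) + (\<alpha>\<^sub>1 + \<alpha>\<^sub>h) * \<alpha>\<^sub>2 * \<alpha>\<^sub>h * \<gamma>\<^sub>2 + \<alpha>\<^sub>1 * \<alpha>\<^sub>2 * \<alpha>\<^sub>h
         + 4 * \<alpha>\<^sub>2^2 * \<alpha>\<^sub>1 * (1 + \<alpha>\<^sub>h) + 2 * \<alpha>\<^sub>1 * \<alpha>\<^sub>2 * \<alpha>\<^sub>h^2 * \<theta>\<^sub>2) \<and>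
      revenue K \<pi> Henry = pmf \<pi> S000 *
        (\<alpha>\<^sub>1 * \<alpha>\<^sub>h^2 * (2 - \<gamma>\<^sub>1) + 2 * \<alpha>\<^sub>1 * \<alpha>\<^sub>2 * \<alpha>\<^sub>h^2 * (2 - \<theta>\<^sub>1 - \<theta>\<^sub>2) + \<alpha>\<^sub>h
         + \<alpha>\<^sub>2 * \<alpha>\<^sub>h^2 * (2 - \<gamma>\<^sub>2) + \<alpha>\<^sub>1 * \<alpha>\<^sub>2 * \<alpha>\<^sub>h * (2 - \<gamma>\<^sub>1 - \<gamma>\<^sub>2)) \<and>
      \<comment> \<open>relative revenues are well defined\<close>
      revenue K \<pi> Alice + revenue K \<pi> Bob + revenue K \<pi> Henry > 0 \<and>
      (\<forall>m. relative_revenue K \<pi> m =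
        revenue K \<pi> m / (revenue K \<pi> Alice + revenue K \<pi> Bob + revenue K \<pi> Henry)) \<and>
      \<comment> \<open>orphaned blocks of Henry\<close>
      mean_orphans K \<pi> Henry = pmf \<pi> S000 *
        ((\<alpha>\<^sub>1 + (1 - \<alpha>\<^sub>1) * \<gamma>\<^sub>1) * \<alpha>\<^sub>1 * \<alpha>\<^sub>h + (\<alpha>\<^sub>2 + (1 - \<alpha>\<^sub>2) * \<gamma>\<^sub>2) * \<alpha>\<^sub>2 * \<alpha>\<^sub>h
         + (\<alpha>\<^sub>1 + \<alpha>\<^sub>2 + (\<theta>\<^sub>1 + \<theta>\<^sub>2) * \<alpha>\<^sub>h) * (2 * \<alpha>\<^sub>1 * \<alpha>\<^sub>2 * \<alpha>\<^sub>h)) \<and>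
      \<comment> \<open>expected numbers of valid and orphaned blocks in a whole mining round\<close>
      (\<forall>m. (\<lambda>n. round_valid K n m) \<longlonglongrightarrow> revenue K \<pi> m / pmf \<pi> S000) \<and>
      (\<forall>m. (\<lambda>n. round_orphans K n m) \<longlonglongrightarrow> mean_orphans K \<pi> m / pmf \<pi> S000) \<and>
      \<comment> \<open>the symmetric special case\<close>
      (\<forall>\<alpha>. \<alpha>\<^sub>1 = \<alpha> \<and> \<alpha>\<^sub>2 = \<alpha> \<and> \<alpha> < 1/2 \<and> \<gamma>\<^sub>1 = 1/2 \<and> \<gamma>\<^sub>2 = 1/2 \<and> \<theta>\<^sub>1 = 1/3 \<and> \<theta>\<^sub>2 = 1/3 \<longrightarrow>
        pmf \<pi> S000 = inverse (1 + 4 * \<alpha> - 4 * \<alpha>^3) \<and>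
        revenue K \<pi> Alice = pmf \<pi> S000 * (1/6) * \<alpha> * (25 * \<alpha> + 2 * \<alpha>^2 + 3 - 32 * \<alpha>^3) \<and>
        revenue K \<pi> Bob = pmf \<pi> S000 * (1/6) * \<alpha> * (25 * \<alpha> + 2 * \<alpha>^2 + 3 - 32 * \<alpha>^3) \<and>
        revenue K \<pi> Henry =
          pmf \<pi> S000 * (1 - 2 * \<alpha>) * (1 + 3 * \<alpha> - (7/3) * \<alpha>^2 - (16/3) * \<alpha>^3)))"
proof -
  interpret M: selfish_mining \<alpha>\<^sub>1 \<alpha>\<^sub>2 \<alpha>\<^sub>h \<gamma>\<^sub>1 \<gamma>\<^sub>2 \<theta>\<^sub>1 \<theta>\<^sub>2
    using assms by unfold_locales
  have K: "K = M.K"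
    unfolding M.K_def by fact
  show ?thesis
    unfolding K
  proof (intro conjI allI impI)
    show "\<exists>!\<pi>. stationary M.K \<pi>"
      by (rule M.ex1_stationary)
  next
    fix \<pi>
    assume st: "stationary M.K \<pi>"
    show "revenue M.K \<pi> Alice + revenue M.K \<pi> Bob + revenue M.K \<pi> Henry > 0"
      using M.revenue_Henry_pos[OF st] M.revenue_nonneg[of \<pi> Alice] M.revenue_nonneg[of \<pi> Bob]
      by linarith
  \<comment> \<open>Each remaining conjunct is a lemma of the locale or the definition of relative
    revenue. Stationarity is discharged by \<open>assumption\<close>; \<open>conjE\<close> extracts
    the parameter values of the symmetric case.\<close>
  qed (assumption | rule M.stationary_S000[unfolded M.steps_per_round_def] M.revenue_Alice
      M.revenue_Bob M.revenue_Henry M.revenue_closed_forms relative_revenue_def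
      M.mean_orphans_Henry_closed_form M.round_valid_tendsto M.round_orphans_tendsto
      M.symmetric_case | (elim conjE, assumption))+
qed

end
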